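(* Let $X=(\boldsymbol X_1,\dots,\boldsymbol X_n)$ be a $p\times n$ random matrix from the multivariate location--scale family with unknown $\boldsymbol\alpha\in\mathbb{R}^p$ and $\boldsymbol\beta=(\beta_1,\dots,\beta_p)$, $\beta_i>0$. Let $r\in\mathbb{R}\setminus\{0\}$ be given, let $U=(\boldsymbol U_1,\dots,\boldsymbol U_{n-1})$ with $\boldsymbol U_j=\boldsymbol X_j-\boldsymbol X_n$, and let $\boldsymbol T(U)=(T_1(U),\dots,T_p(U))$ be an equivariant estimator of $\boldsymbol\beta^{(r)}=(\beta_1^r,\dots,\beta_p^r)$ based on $U$ with $T_i(U)>0$ almost everywhere for each $i$. Under the strictly convex loss $L(\boldsymbol d,\boldsymbol\beta)=\sum_{i=1}^p h(d_i/\beta_i^r)$, with $h$ strictly convex, a Pitman closest equivariant estimator of $\boldsymbol\beta^{(r)}$ within the class of estimators of the form $\boldsymbol\delta(X)=w(Z)\,\boldsymbol T(U)$, with $w$ a scalar-valued function of $Z$, is $$\boldsymbol\delta_\pi(X)=m(Z)\,\boldsymbol T(U),$$ where $m(Z)$ is a median of the conditional distribution, given $Z$ and under $(\boldsymbol\alpha,\boldsymbol\beta)=(\mathbf 0,\mathbf 1)$, of the univariate random variable $c^*$ defined by $$\boldsymbol T(U)^{\top}\,\nabla\tilde L\big(\mathbf 1-c^*\boldsymbol T(U)\big)=0,\qquad \tilde L(\boldsymbol e)=\sum_{i=1}^p h(1-e_i)\quad(\boldsymbol e\in\mathbb{R}^p),$$ so that $L(\boldsymbol d,\mathbf 1)=\tilde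 L(\mathbf 1-\boldsymbol d)$.
   Context: Multivariate location--scale family: $X=(\boldsymbol X_1,\dots,\boldsymbol X_n)$ is a $p\times n$ random matrix with joint density $f_{P,\boldsymbol\alpha}(\boldsymbol x_1,\dots,\boldsymbol x_n)=|P|^{-n}f(P^{-1}(\boldsymbol x_1-\boldsymbol\alpha),\dots,P^{-1}(\boldsymbol x_n-\boldsymbol\alpha))$, where $f$ is a given density, $\boldsymbol\alpha\in\mathbb{R}^p$ is an unknown location vector, $P=\mathrm{diag}(\beta_1,\dots,\beta_p)$ with $\beta_i>0$ is an unknown diagonal scale matrix, and $|P|$ is its determinant. Equivariance: an estimator $T(X)$ of $\boldsymbol\beta^{(r)}$ is equivariant if $T(CX+\boldsymbol a\mathbf 1^{\top})=C^rT(X)$ for all $\boldsymbol a\in\mathbb{R}^p$ and all $C=\mathrm{diag}(c_1,\dots,c_p)$ with $c_i>0$, where $\boldsymbol a\mathbf 1^{\top}$ is the $p\times n$ matrix all of whose columns equal $\boldsymbol a$. For an estimator that is a function $\boldsymbol T(U)$ of $U$ this means $\boldsymbol T(CU)=C^r\boldsymbol T(U)$. The statistic $Z$: writing $U=(u_{i,j})$ ($p\times(n-1)$), $Z=(z_{i,j})$ is the $p\times(n-1)$ matrix with $z_{i,j}=u_{i,j}/u_{i,1}$ for $j\ne1$ and $z_{i,1}=u_{i,1}/|u_{i,1}|$. Pitman closeness: for estimators $T_1,T_2$, $\mathrm{PC}(T_1,T_2;\boldsymbol\alpha,\boldsymbol\beta)=P_{\boldsymbol\alpha,\boldsymbol\beta}[L(T_1(X),\boldsymbol\beta)<L(T_2(X),\boldsymbol\beta)]$.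 An estimator $T_1$ in a class is a Pitman closest estimator in the class if $\mathrm{PC}(T_1,T_2;\boldsymbol\alpha,\boldsymbol\beta)\ge\mathrm{PC}(T_2,T_1;\boldsymbol\alpha,\boldsymbol\beta)$ for all $(\boldsymbol\alpha,\boldsymbol\beta)$ and every $T_2$ in the class. Here $h$ is a real-valued function on $\mathbb{R}$, and $\mathbf 1=(1,\dots,1)$. Median: a number $m$ is a median of a univariate random variable $W$ if $P(W<m)\le 1/2$ and $P(W\le m)\ge 1/2$ (similarly for conditional distributions). *)

theory Defs
  imports "HOL-Probability.Probability"
begin

text \<open>
  A p by n data matrix has type \<open>real ^ 'm option ^ 'p\<close>, with p = CARD('p) and n = CARD('m) + 1.
  The column index \<open>None\<close> plays the role of the last index n, and \<open>Some j\<close> ranges over the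
  indices 1, ..., n - 1, so that matrices of differences to the last column have type
  \<open>real ^ 'm ^ 'p\<close>.
\<close>

definition diag_mat :: "real ^ 'p \<Rightarrow> real ^ 'p ^ 'p" where
  "diag_mat b = (\<chi> i j. if i = j then b $ i else 0)"

definition const_cols :: "real ^ 'p \<Rightarrow> real ^ 'n ^ 'p" where
  "const_cols a = (\<chi> i j. a $ i)"

definition powr_vec :: "real ^ 'p \<Rightarrow> real \<Rightarrow> real ^ 'p" where
  "powr_vec b r = (\<chi> i. b $ i powr r)"

definition pos_vec :: "real ^ 'p \<Rightarrow> bool" where
  "pos_vec b \<longleftrightarrow> (\<forall>i. 0 < b $ i)"

definition is_density :: "('b :: euclidean_space \<Rightarrow> real) \<Rightarrow> bool" where
  "is_density f \<longleftrightarrow> f \<in> borel_measurable borel \<and> (\<forall>x. 0 \<le> f x) \<and>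
     (\<integral>\<^sup>+ x. ennreal (f x) \<partial>lborel) = 1"

definition location_scale_density ::
  "(real ^ 'n ^ 'p \<Rightarrow> real) \<Rightarrow> real ^ 'p \<Rightarrow> real ^ 'p \<Rightarrow> real ^ 'n ^ 'p \<Rightarrow> real" where
  "location_scale_density f \<alpha> \<beta> x =
     f (matrix_inv (diag_mat \<beta>) ** (x - const_cols \<alpha>)) / det (diag_mat \<beta>) ^ CARD('n)"

text \<open>
  \<open>M \<alpha> \<beta>\<close> is the underlying probability space when the true parameter is \<open>(\<alpha>, \<beta>)\<close>.
\<close>

definition location_scale_model ::
  "(real ^ 'n ^ 'p \<Rightarrow> real) \<Rightarrow> (real ^ 'p \<Rightarrow> real ^ 'p \<Rightarrow> 'a measure) \<Rightarrow>
   ('a \<Rightarrow> real ^ 'n ^ 'p) \<Rightarrow> bool" where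
  "location_scale_model f M X \<longleftrightarrow> is_density f \<and>
     (\<forall>\<alpha> \<beta>. pos_vec \<beta> \<longrightarrow> prob_space (M \<alpha> \<beta>) \<and>
        distributed (M \<alpha> \<beta>) lborel X (\<lambda>x. ennreal (location_scale_density f \<alpha> \<beta> x)))"

definition equivariant :: "real \<Rightarrow> (real ^ 'n ^ 'p \<Rightarrow> real ^ 'p) \<Rightarrow> bool" where
  "equivariant r \<delta> \<longleftrightarrow> (\<forall>a c x. pos_vec c \<longrightarrow>
     \<delta> (diag_mat c ** x + const_cols a) = diag_mat (powr_vec c r) *v \<delta> x)"

definition U_stat :: "real ^ 'm option ^ 'p \<Rightarrow> real ^ 'm ^ 'p" where
  "U_stat x = (\<chi> i j. x $ i $ Some j - x $ i $ None)"

text \<open>The index \<open>j1\<close> is the one of the first column.\<close>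

definition Z_stat :: "'m \<Rightarrow> real ^ 'm ^ 'p \<Rightarrow> real ^ 'm ^ 'p" where
  "Z_stat j1 u = (\<chi> i j. if j = j1 then u $ i $ j1 / \<bar>u $ i $ j1\<bar> else u $ i $ j / u $ i $ j1)"

definition strictly_convex :: "(real \<Rightarrow> real) \<Rightarrow> bool" where
  "strictly_convex h \<longleftrightarrow> (\<forall>x y t. x \<noteq> y \<longrightarrow> 0 < t \<longrightarrow> t < 1 \<longrightarrow>
     h ((1 - t) * x + t * y) < (1 - t) * h x + t * h y)"

definition scale_loss :: "(real \<Rightarrow> real) \<Rightarrow> real \<Rightarrow> real ^ 'p \<Rightarrow> real ^ 'p \<Rightarrow> real" where
  "scale_loss h r d \<beta> = (\<Sum>i\<in>UNIV. h (d $ i / (\<beta> $ i) powr r))"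

definition L_tilde :: "(real \<Rightarrow> real) \<Rightarrow> real ^ 'p \<Rightarrow> real" where
  "L_tilde h e = (\<Sum>i\<in>UNIV. h (1 - e $ i))"

text \<open>
  The equation \<open>t\<^sup>T \<nabla>L_tilde (1 - c t) = 0\<close>, including the existence of the gradient at that point;
  the constant \<open>1\<close> is the vector all of whose components are 1.
\<close>

definition c_star_equation :: "(real \<Rightarrow> real) \<Rightarrow> real ^ 'p \<Rightarrow> real \<Rightarrow> bool" where
  "c_star_equation h t c \<longleftrightarrow> (\<exists>g. GDERIV (L_tilde h) (1 - c *\<^sub>R t) :> g \<and> t \<bullet> g = 0)"

definition PC ::
  "(real ^ 'p \<Rightarrow> real ^ 'p \<Rightarrow> 'a measure) \<Rightarrow> ('a \<Rightarrow> 'x) \<Rightarrow> (real ^ 'p \<Rightarrow> real ^ 'p \<Rightarrow> real) \<Rightarrow>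
   ('x \<Rightarrow> real ^ 'p) \<Rightarrow> ('x \<Rightarrow> real ^ 'p) \<Rightarrow> real ^ 'p \<Rightarrow> real ^ 'p \<Rightarrow> real" where
  "PC M X L T\<^sub>1 T\<^sub>2 \<alpha> \<beta> =
     measure (M \<alpha> \<beta>) {\<omega> \<in> space (M \<alpha> \<beta>). L (T\<^sub>1 (X \<omega>)) \<beta> < L (T\<^sub>2 (X \<omega>)) \<beta>}"

definition pitman_closest ::
  "(real ^ 'p \<Rightarrow> real ^ 'p \<Rightarrow> 'a measure) \<Rightarrow> ('a \<Rightarrow> 'x) \<Rightarrow> (real ^ 'p \<Rightarrow> real ^ 'p \<Rightarrow> real) \<Rightarrow>
   ('x \<Rightarrow> real ^ 'p) set \<Rightarrow> ('x \<Rightarrow> real ^ 'p) \<Rightarrow> bool" where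
  "pitman_closest M X L \<C> T\<^sub>1 \<longleftrightarrow> T\<^sub>1 \<in> \<C> \<and>
     (\<forall>T\<^sub>2\<in>\<C>. \<forall>\<alpha> \<beta>. pos_vec \<beta> \<longrightarrow> PC M X L T\<^sub>1 T\<^sub>2 \<alpha> \<beta> \<ge> PC M X L T\<^sub>2 T\<^sub>1 \<alpha> \<beta>)"

definition Z_multiples ::
  "'m \<Rightarrow> (real ^ 'm ^ 'p \<Rightarrow> real ^ 'p) \<Rightarrow> (real ^ 'm option ^ 'p \<Rightarrow> real ^ 'p) set" where
  "Z_multiples j1 T =
     {\<delta>. \<exists>w \<in> borel_measurable borel. \<delta> = (\<lambda>x. w (Z_stat j1 (U_stat x)) *\<^sub>R T (U_stat x))}"

definition is_median :: "real measure \<Rightarrow> real \<Rightarrow> bool" where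
  "is_median \<mu> m \<longleftrightarrow> measure \<mu> {..<m} \<le> 1 / 2 \<and> measure \<mu> {..m} \<ge> 1 / 2"

definition conditional_distribution ::
  "'a measure \<Rightarrow> ('a \<Rightarrow> 'z :: topological_space) \<Rightarrow> ('a \<Rightarrow> real) \<Rightarrow> ('z \<Rightarrow> real measure) \<Rightarrow> bool" where
  "conditional_distribution N Z W \<kappa> \<longleftrightarrow> \<kappa> \<in> borel \<rightarrow>\<^sub>M prob_algebra borel \<and>
     (\<forall>A\<in>sets borel. \<forall>B\<in>sets borel.
        emeasure N {\<omega> \<in> space N. Z \<omega> \<in> A \<and> W \<omega> \<in> B} =
        (\<integral>\<^sup>+ z \<in> A. emeasure (\<kappa> z) B \<partial>(distr N borel Z)))"

end

theory Submission
  imports Defs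
begin

text \<open>
  All competitors are multiples \<open>w (Z) T (U)\<close> of one vector, so comparing two of them is a
  one-dimensional problem. Along the ray spanned by \<open>t = T (U)\<close>, with positive entries, the loss
  \<open>c \<mapsto> \<Sum>i. h (c t\<^sub>i)\<close> is strictly convex, and \<open>c*\<close> is its critical point, hence its minimizer.
  Whenever \<open>m\<close> lies between \<open>w\<close> and \<open>c*\<close> and differs from \<open>w\<close>, that is
  \<open>w < m \<le> c*\<close> or \<open>c* \<le> m < w\<close>, the multiple \<open>m\<close> has strictly smaller loss than \<open>w\<close>
  (\<open>strictly_convex_less_towards_minimizer\<close>).

  Given \<open>Z\<close>, the numbers \<open>w (Z)\<close> and \<open>m (Z)\<close> are fixed. If \<open>w (Z) < m (Z)\<close>, the median beats
  \<open>w\<close> at least when \<open>m (Z) \<le> c*\<close>, which has conditional probability at least 1/2, and loses at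
  most when \<open>c* < m (Z)\<close>, which has conditional probability at most 1/2; the case
  \<open>m (Z) < w (Z)\<close> is symmetric, and for \<open>w (Z) = m (Z)\<close> the losses agree. Integrating over \<open>Z\<close>
  (\<open>conditional_median_tails\<close>) gives the comparison under the parameter \<open>(0, 1)\<close>.

  For the other parameters, scaling the rows and shifting the columns of the data maps the law
  under \<open>(0, 1)\<close> to the law under \<open>(\<alpha>, \<beta>)\<close>, and the loss of an equivariant estimator is unchanged
  when data and parameter are transformed together (\<open>PC_equivariant\<close>). As \<open>Z\<close> is invariant under
  this action, every multiple \<open>w (Z) T (U)\<close> is equivariant.
\<close>

section \<open>Strict convexity along the ray of multiples\<close>

lemma strictly_convexD:
  assumes "strictly_convex h" "x \<noteq> y" "0 < t" "t < 1"
  shows "h ((1 - t) * x + t * y) < (1 - t) * h x + t * h y"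
  using assms unfolding strictly_convex_def by blast

lemma convex_on_UNIV_if_strictly_convex:
  assumes "strictly_convex h"
  shows "convex_on UNIV h"
proof (rule convex_onI)
  fix t x y :: real
  assume "0 < t" "t < 1"
  then show "h ((1 - t) *\<^sub>R x + t *\<^sub>R y) \<le> (1 - t) * h x + t * h y"
    using strictly_convexD[OF assms, of x y t]
    by (cases "x = y") (simp_all add: algebra_simps)
qed simp

lemma borel_measurable_if_strictly_convex:
  assumes "strictly_convex h"
  shows "h \<in> borel_measurable borel"
  by (intro borel_measurable_continuous_onI convex_on_continuous
      convex_on_UNIV_if_strictly_convex assms) simp

text \<open>
  A strictly convex function decreases strictly towards its minimizer. The point \<open>m\<close> may itself be
  the minimizer; this boundary case makes the weak inequality in the definition of a median
  match the strict inequality in the definition of Pitman closeness.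
\<close>
lemma strictly_convex_less_towards_minimizer:
  assumes cvx: "strictly_convex \<phi>"
    and min: "\<And>x. \<phi> c \<le> \<phi> x"
    and between: "w < m \<and> m \<le> c \<or> c \<le> m \<and> m < w"
  shows "\<phi> m < \<phi> w"
proof -
  have wc: "w \<noteq> c"
    using between by auto
  \<comment> \<open>The midpoint of w and c shows that the minimum is not attained at w.\<close>
  have "\<phi> ((1 - 1/2) * w + 1/2 * c) < (1 - 1/2) * \<phi> w + 1/2 * \<phi> c"
    by (rule strictly_convexD[OF cvx wc]) simp_all
  with min[of "(1 - 1/2) * w + 1/2 * c"] have unique: "\<phi> c < \<phi> w"
    by simp
  show ?thesis
  proof (cases "m = c")
    case False
    define t where "t = (m - w) / (c - w)"
    have t: "0 < t" "t < 1"
      using between False wc by (auto simp: t_def field_simps)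
    have "t * (c - w) = m - w"
      using wc by (simp add: t_def)
    then have "m = (1 - t) * w + t * c"
      by (simp add: algebra_simps)
    then have "\<phi> m < (1 - t) * \<phi> w + t * \<phi> c"
      using strictly_convexD[OF cvx wc t] by simp
    also have "\<dots> \<le> (1 - t) * \<phi> w + t * \<phi> w"
      using t unique by simp
    finally show ?thesis
      by (simp add: algebra_simps)
  qed (use unique in simp)
qed

lemma strictly_convex_scale_loss_multiple:
  fixes t :: "real ^ 'p"
  assumes h: "strictly_convex h" and t: "pos_vec t"
  shows "strictly_convex (\<lambda>c. scale_loss h r (c *\<^sub>R t) 1)"
  unfolding strictly_convex_def
proof (intro allI impI)
  fix x y s :: real
  assume s: "x \<noteq> y" "0 < s" "s < 1"
  have "h (((1 - s) * x + s * y) * t $ i) < (1 - s) * h (x * t $ i) + s * h (y * t $ i)" for i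
  proof -
    have "x * t $ i \<noteq> y * t $ i"
      using t s by (auto simp: pos_vec_def less_le)
    then have "h ((1 - s) * (x * t $ i) + s * (y * t $ i)) < (1 - s) * h (x * t $ i) + s * h (y * t $ i)"
      using s by (intro strictly_convexD[OF h])
    then show ?thesis
      by (simp add: algebra_simps)
  qed
  then show "scale_loss h r (((1 - s) * x + s * y) *\<^sub>R t) 1
      < (1 - s) * scale_loss h r (x *\<^sub>R t) 1 + s * scale_loss h r (y *\<^sub>R t) 1"
    by (simp add: scale_loss_def sum_distrib_left sum.distrib[symmetric] sum_strict_mono)
qed

text \<open>
  The equation for \<open>c\<close> is the vanishing of the derivative of the loss along the ray
  \<open>c \<mapsto> c t\<close>, and for a convex function a critical point is a global minimum.
\<close>
lemma c_star_equation_minimizes: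
  fixes t :: "real ^ 'p"
  assumes h: "strictly_convex h" and t: "pos_vec t" and c: "c_star_equation h t c"
  shows "scale_loss h r (c *\<^sub>R t) 1 \<le> scale_loss h r (x *\<^sub>R t) 1"
proof -
  have loss: "(\<lambda>c. scale_loss h r (c *\<^sub>R t) 1) = (\<lambda>c. L_tilde h (1 - c *\<^sub>R t))"
    by (simp add: fun_eq_iff scale_loss_def L_tilde_def)
  obtain g where g: "(L_tilde h has_derivative (\<lambda>v. inner v g)) (at (1 - c *\<^sub>R t))"
    and tg: "inner t g = 0"
    using c unfolding c_star_equation_def gderiv_def by blast
  have "((\<lambda>c. 1 - c *\<^sub>R t) has_derivative (\<lambda>v. - (v *\<^sub>R t))) (at c)"
    by (auto intro!: derivative_eq_intros)
  from has_derivative_compose[OF this g]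
  have "((\<lambda>c. L_tilde h (1 - c *\<^sub>R t)) has_derivative (\<lambda>v. 0)) (at c)"
    by (simp add: tg)
  then have "((\<lambda>c. scale_loss h r (c *\<^sub>R t) 1) has_field_derivative 0) (at c)"
    unfolding loss has_field_derivative_def by (simp add: lambda_zero)
  from convex_on_imp_above_tangent[OF convex_on_UNIV_if_strictly_convex
      [OF strictly_convex_scale_loss_multiple[OF h t]] _ _ _ this, of x]
  show ?thesis
    by simp
qed

section \<open>Conditional distributions and conditional medians\<close>

text \<open>
  The definition of a conditional distribution speaks of rectangles only. The events needed below
  compare \<open>W\<close> with the varying bound \<open>m (Z)\<close>, so the disintegration is extended to all measurable
  sets; both sides are probability measures in \<open>E\<close>, and rectangles form a generator that is stable
  under intersection.
\<close>
lemma conditional_distribution_joint: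
  assumes N: "prob_space N"
    and Z[measurable]: "Z \<in> borel_measurable N" and W[measurable]: "W \<in> borel_measurable N"
    and cd: "conditional_distribution N Z W \<kappa>"
    and E: "E \<in> sets (borel \<Otimes>\<^sub>M borel)"
  shows "emeasure N {\<omega> \<in> space N. (Z \<omega>, W \<omega>) \<in> E}
    = (\<integral>\<^sup>+ z. emeasure (\<kappa> z) (Pair z -` E) \<partial>distr N borel Z)"
proof -
  interpret N: prob_space N by fact
  interpret D: prob_space "distr N borel Z"
    by (rule N.prob_space_distr) simp
  have \<kappa>: "\<kappa> \<in> borel \<rightarrow>\<^sub>M prob_algebra borel"
    using cd by (simp add: conditional_distribution_def)
  note \<kappa>_sub[measurable] = measurable_prob_algebraD[OF \<kappa>]
  have sets_\<kappa>: "sets (\<kappa> z) = sets borel" and prob_\<kappa>: "prob_space (\<kappa> z)" for z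
    using measurable_space[OF \<kappa>, of z] by (auto simp: space_prob_algebra)
  have meas: "(\<lambda>z. emeasure (\<kappa> z) (Pair z -` E)) \<in> borel_measurable borel"
    if [measurable]: "E \<in> sets (borel \<Otimes>\<^sub>M borel)" for E
  proof (rule emeasure_measurable_subprob_algebra2[OF _ \<kappa>_sub])
    have "(SIGMA z:space borel. Pair z -` E) = E"
      by auto
    then show "(SIGMA z:space borel. Pair z -` E) \<in> sets (borel \<Otimes>\<^sub>M borel)"
      using that by simp
  qed
  have sec: "Pair z -` E \<in> sets (\<kappa> z)" if "E \<in> sets (borel \<Otimes>\<^sub>M borel)" for E z
    using sets_Pair1[OF that, of z] sets_\<kappa> by simp
  have E': "E \<in> sigma_sets (UNIV \<times> UNIV) {a \<times> b | a b. a \<in> sets borel \<and> b \<in> sets borel}"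
    using E by (simp add: sets_pair_measure)
  have in_sets: "A \<in> sets (borel \<Otimes>\<^sub>M borel)"
    if "A \<in> sigma_sets (UNIV \<times> UNIV) {a \<times> b | a b. a \<in> sets borel \<and> b \<in> sets borel}" for A :: "('b \<times> real) set"
    using that by (simp add: sets_pair_measure)
  have closed: "{a \<times> b | a b. a \<in> sets borel \<and> b \<in> sets borel} \<subseteq> Pow (UNIV \<times> UNIV :: ('b \<times> real) set)"
    by auto
  show ?thesis
    using Int_stable_pair_measure_generator closed E'
  proof (induction rule: sigma_sets_induct_disjoint)
    case (basic A)
    then obtain a b where A: "A = a \<times> b" and ab: "a \<in> sets borel" "b \<in> sets borel"
      by auto
    have sect: "Pair z -` (a \<times> b) = (if z \<in> a then b else {})" for z
      by auto
    have "emeasure N {\<omega> \<in> space N. (Z \<omega>, W \<omega>) \<in> A}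
        = (\<integral>\<^sup>+ z \<in> a. emeasure (\<kappa> z) b \<partial>(distr N borel Z))"
      using cd ab unfolding conditional_distribution_def A by simp
    also have "\<dots> = (\<integral>\<^sup>+ z. emeasure (\<kappa> z) (Pair z -` A) \<partial>distr N borel Z)"
      by (intro nn_integral_cong) (auto simp: A sect split: split_indicator)
    finally show ?case .
  next
    case empty
    show ?case by simp
  next
    case (compl A)
    have A[measurable]: "A \<in> sets (borel \<Otimes>\<^sub>M borel)"
      using compl.hyps by (rule in_sets)
    have "emeasure N {\<omega> \<in> space N. (Z \<omega>, W \<omega>) \<in> UNIV \<times> UNIV - A}
        = emeasure N (space N - {\<omega> \<in> space N. (Z \<omega>, W \<omega>) \<in> A})"
      by (intro arg_cong[where f="emeasure N"]) auto
    also have "\<dots> = 1 - emeasure N {\<omega> \<in> space N. (Z \<omega>, W \<omega>) \<in> A}"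
      by (subst emeasure_compl) (auto simp: N.emeasure_space_1)
    also have "\<dots> = (\<integral>\<^sup>+ z. 1 \<partial>distr N borel Z) - (\<integral>\<^sup>+ z. emeasure (\<kappa> z) (Pair z -` A) \<partial>distr N borel Z)"
      using compl.IH D.emeasure_space_1 by simp
    also have "\<dots> = (\<integral>\<^sup>+ z. 1 - emeasure (\<kappa> z) (Pair z -` A) \<partial>distr N borel Z)"
    proof (rule nn_integral_diff[symmetric])
      show "(\<integral>\<^sup>+ z. emeasure (\<kappa> z) (Pair z -` A) \<partial>distr N borel Z) \<noteq> \<infinity>"
        unfolding compl.IH[symmetric] by simp
      show "AE z in distr N borel Z. emeasure (\<kappa> z) (Pair z -` A) \<le> 1"
        using prob_space.emeasure_le_1[OF prob_\<kappa>] by auto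
    qed (use meas[OF A] in auto)
    also have "\<dots> = (\<integral>\<^sup>+ z. emeasure (\<kappa> z) (Pair z -` (UNIV \<times> UNIV - A)) \<partial>distr N borel Z)"
    proof (intro nn_integral_cong)
      fix z
      have sp: "space (\<kappa> z) = UNIV"
        using sets_eq_imp_space_eq[OF sets_\<kappa>[of z]] by simp
      have "Pair z -` (UNIV \<times> UNIV - A) = space (\<kappa> z) - Pair z -` A"
        unfolding sp by auto
      moreover have "emeasure (\<kappa> z) (space (\<kappa> z) - Pair z -` A) = 1 - emeasure (\<kappa> z) (Pair z -` A)"
        using prob_space.emeasure_space_1[OF prob_\<kappa>[of z]] sec[OF A, of z]
          prob_space.emeasure_le_1[OF prob_\<kappa>[of z], of "Pair z -` A"]
        by (subst emeasure_compl) (auto simp: top_unique)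
      ultimately show "1 - emeasure (\<kappa> z) (Pair z -` A) = emeasure (\<kappa> z) (Pair z -` (UNIV \<times> UNIV - A))"
        by simp
    qed
    finally show ?case .
  next
    case (union A)
    have A[measurable]: "A i \<in> sets (borel \<Otimes>\<^sub>M borel)" for i
      using union.hyps by (intro in_sets) auto
    have "emeasure N {\<omega> \<in> space N. (Z \<omega>, W \<omega>) \<in> (\<Union>i. A i)}
        = emeasure N (\<Union>i. {\<omega> \<in> space N. (Z \<omega>, W \<omega>) \<in> A i})"
      by (intro arg_cong[where f="emeasure N"]) auto
    also have "\<dots> = (\<Sum>i. emeasure N {\<omega> \<in> space N. (Z \<omega>, W \<omega>) \<in> A i})"
      using union.hyps(1)
      by (intro suminf_emeasure[symmetric]) (auto simp: disjoint_family_on_def)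
    also have "\<dots> = (\<integral>\<^sup>+ z. (\<Sum>i. emeasure (\<kappa> z) (Pair z -` A i)) \<partial>distr N borel Z)"
      unfolding union.IH by (intro nn_integral_suminf[symmetric]) (use meas[OF A] in simp)
    also have "\<dots> = (\<integral>\<^sup>+ z. emeasure (\<kappa> z) (Pair z -` (\<Union>i. A i)) \<partial>distr N borel Z)"
      unfolding vimage_UN using union.hyps(1) sec[OF A]
      by (intro nn_integral_cong suminf_emeasure) (auto simp: disjoint_family_on_def)
    finally show ?case .
  qed
qed

lemma is_median_tails:
  assumes "prob_space \<mu>" and sets: "sets \<mu> = sets borel" and med: "is_median \<mu> m"
  shows "emeasure \<mu> {..<m} \<le> emeasure \<mu> {m..}" "emeasure \<mu> {m<..} \<le> emeasure \<mu> {..m}"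
proof -
  interpret prob_space \<mu> by fact
  have sp: "space \<mu> = UNIV"
    using sets_eq_imp_space_eq[OF sets] by simp
  have "space \<mu> - {..<m} = {m..}" "space \<mu> - {..m} = {m<..}"
    unfolding sp by auto
  then have "measure \<mu> {m..} = 1 - measure \<mu> {..<m}" "measure \<mu> {m<..} = 1 - measure \<mu> {..m}"
    using prob_compl[of "{..<m}"] prob_compl[of "{..m}"] sets by auto
  then show "emeasure \<mu> {..<m} \<le> emeasure \<mu> {m..}" "emeasure \<mu> {m<..} \<le> emeasure \<mu> {..m}"
    using med by (auto simp: is_median_def emeasure_eq_measure)
qed

text \<open>
  Integrating the two inequalities between the tails of the conditional distribution over the
  values of \<open>Z\<close> in \<open>A\<close>: an event that is determined by \<open>Z\<close> does not affect on which side of the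
  conditional median \<open>W\<close> is more likely to fall.
\<close>
lemma conditional_median_tails:
  assumes N: "prob_space N"
    and Z[measurable]: "Z \<in> borel_measurable N" and W[measurable]: "W \<in> borel_measurable N"
    and cd: "conditional_distribution N Z W \<kappa>"
    and m[measurable]: "m \<in> borel_measurable borel"
    and med: "AE z in distr N borel Z. is_median (\<kappa> z) (m z)"
    and A[measurable]: "A \<in> sets borel"
  shows "measure N {\<omega> \<in> space N. Z \<omega> \<in> A \<and> W \<omega> < m (Z \<omega>)}
      \<le> measure N {\<omega> \<in> space N. Z \<omega> \<in> A \<and> m (Z \<omega>) \<le> W \<omega>}" (is ?lower)
    and "measure N {\<omega> \<in> space N. Z \<omega> \<in> A \<and> m (Z \<omega>) < W \<omega>}
      \<le> measure N {\<omega> \<in> space N. Z \<omega> \<in> A \<and> W \<omega> \<le> m (Z \<omega>)}" (is ?upper)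
proof -
  interpret N: prob_space N by fact
  have \<kappa>: "\<kappa> \<in> borel \<rightarrow>\<^sub>M prob_algebra borel"
    using cd by (simp add: conditional_distribution_def)
  have \<kappa>z: "sets (\<kappa> z) = sets borel" "prob_space (\<kappa> z)" for z
    using measurable_space[OF \<kappa>, of z] by (auto simp: space_prob_algebra)
  have law: "emeasure N {\<omega> \<in> space N. Z \<omega> \<in> A \<and> P (W \<omega>) (m (Z \<omega>))}
      = (\<integral>\<^sup>+ z. emeasure (\<kappa> z) {y. z \<in> A \<and> P y (m z)} \<partial>distr N borel Z)"
    if "{x. case x of (z, y) \<Rightarrow> z \<in> A \<and> P y (m z)} \<in> sets (borel \<Otimes>\<^sub>M borel)"
    for P :: "real \<Rightarrow> real \<Rightarrow> bool"
    using conditional_distribution_joint[OF N Z W cd that] by (simp add: vimage_def)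
  have pred: "{x \<in> space (borel \<Otimes>\<^sub>M borel). case x of (z, y) \<Rightarrow> z \<in> A \<and> y < m z} \<in> sets (borel \<Otimes>\<^sub>M borel)"
    "{x \<in> space (borel \<Otimes>\<^sub>M borel). case x of (z, y) \<Rightarrow> z \<in> A \<and> y \<le> m z} \<in> sets (borel \<Otimes>\<^sub>M borel)"
    "{x \<in> space (borel \<Otimes>\<^sub>M borel). case x of (z, y) \<Rightarrow> z \<in> A \<and> m z < y} \<in> sets (borel \<Otimes>\<^sub>M borel)"
    "{x \<in> space (borel \<Otimes>\<^sub>M borel). case x of (z, y) \<Rightarrow> z \<in> A \<and> m z \<le> y} \<in> sets (borel \<Otimes>\<^sub>M borel)"
    by measurable
  have "emeasure N {\<omega> \<in> space N. Z \<omega> \<in> A \<and> W \<omega> < m (Z \<omega>)}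
      \<le> emeasure N {\<omega> \<in> space N. Z \<omega> \<in> A \<and> m (Z \<omega>) \<le> W \<omega>}"
  proof (subst (1 2) law)
    show "(\<integral>\<^sup>+ z. emeasure (\<kappa> z) {y. z \<in> A \<and> y < m z} \<partial>distr N borel Z)
        \<le> (\<integral>\<^sup>+ z. emeasure (\<kappa> z) {y. z \<in> A \<and> m z \<le> y} \<partial>distr N borel Z)"
    proof (rule nn_integral_mono_AE, use med in eventually_elim)
      case (elim z)
      then show ?case
        using is_median_tails(1)[OF \<kappa>z(2,1)]
        by (cases "z \<in> A") (simp_all add: lessThan_def atLeast_def)
    qed
  qed (use pred in \<open>simp_all add: space_pair_measure\<close>)
  then show ?lower
    by (simp add: N.emeasure_eq_measure)
  have "emeasure N {\<omega> \<in> space N. Z \<omega> \<in> A \<and> m (Z \<omega>) < W \<omega>}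
      \<le> emeasure N {\<omega> \<in> space N. Z \<omega> \<in> A \<and> W \<omega> \<le> m (Z \<omega>)}"
  proof (subst (1 2) law)
    show "(\<integral>\<^sup>+ z. emeasure (\<kappa> z) {y. z \<in> A \<and> m z < y} \<partial>distr N borel Z)
        \<le> (\<integral>\<^sup>+ z. emeasure (\<kappa> z) {y. z \<in> A \<and> y \<le> m z} \<partial>distr N borel Z)"
    proof (rule nn_integral_mono_AE, use med in eventually_elim)
      case (elim z)
      then show ?case
        using is_median_tails(2)[OF \<kappa>z(2,1)]
        by (cases "z \<in> A") (simp_all add: greaterThan_def atMost_def)
    qed
  qed (use pred in \<open>simp_all add: space_pair_measure\<close>)
  then show ?upper
    by (simp add: N.emeasure_eq_measure)
qed

section \<open>The group action and the location-scale model\<close>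

lemma pos_vec_1: "pos_vec 1"
  by (simp add: pos_vec_def)

lemma diag_mat_mult_nth: "(diag_mat c ** x) $ i $ j = c $ i * x $ i $ j"
  by (simp add: diag_mat_def matrix_matrix_mult_def if_distrib[of "\<lambda>y. y * _"] cong: if_cong)

lemma const_cols_nth: "const_cols a $ i $ j = a $ i"
  by (simp add: const_cols_def)

lemma diag_mat_mult_vec_nth: "(diag_mat c *v x) $ i = c $ i * x $ i"
  by (simp add: diag_mat_def matrix_vector_mult_def if_distrib[of "\<lambda>y. y * _"] cong: if_cong)

lemma det_diag_mat: "det (diag_mat b) = (\<Prod>i\<in>UNIV. b $ i)"
  by (subst det_diagonal) (auto simp: diag_mat_def)

lemma diag_mat_mult_inverse:
  assumes "pos_vec b"
  shows "diag_mat b ** diag_mat (\<chi> i. inverse (b $ i)) = mat 1"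
    and "diag_mat (\<chi> i. inverse (b $ i)) ** diag_mat b = mat 1"
  using assms by (auto simp: vec_eq_iff diag_mat_def matrix_matrix_mult_def mat_def pos_vec_def less_le
      if_distrib[of "\<lambda>y. y * _"] cong: if_cong)

lemma matrix_inv_diag_mat_mult:
  assumes "pos_vec b"
  shows "matrix_inv (diag_mat b) ** (diag_mat b ** x) = x"
proof -
  have "invertible (diag_mat b)"
    using diag_mat_mult_inverse[OF assms] unfolding invertible_def by blast
  then have "matrix_inv (diag_mat b) ** diag_mat b = mat 1"
    unfolding invertible_def matrix_inv_def by (rule someI2_ex) simp
  then show ?thesis
    by (simp add: matrix_mul_assoc)
qed

lemma Z_stat_U_stat_invariant:
  assumes "pos_vec c"
  shows "Z_stat j1 (U_stat (diag_mat c ** x + const_cols a)) = Z_stat j1 (U_stat x)"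
proof -
  have "c $ i \<noteq> 0" "\<bar>c $ i\<bar> = c $ i" for i
    using assms by (simp_all add: pos_vec_def less_imp_neq[THEN not_sym] less_imp_le)
  then show ?thesis
    by (simp add: vec_eq_iff Z_stat_def U_stat_def diag_mat_mult_nth const_cols_nth abs_mult
        right_diff_distrib[symmetric])
qed

lemma equivariant_Z_multiple:
  assumes "equivariant r (\<lambda>x. T (U_stat x))"
  shows "equivariant r (\<lambda>x. w (Z_stat j1 (U_stat x)) *\<^sub>R T (U_stat x))"
  using assms unfolding equivariant_def
  by (simp add: Z_stat_U_stat_invariant matrix_vector_mult_scaleR)

lemma borel_measurable_vec_lambda:
  fixes f :: "'a \<Rightarrow> 'n::finite \<Rightarrow> 'b::euclidean_space"
  assumes "\<And>i. (\<lambda>x. f x i) \<in> borel_measurable M"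
  shows "(\<lambda>x. \<chi> i. f x i) \<in> borel_measurable M"
  unfolding borel_measurable_euclidean_space[of "\<lambda>x. \<chi> i. f x i"]
  using assms by (auto simp: Basis_vec_def inner_axis)

lemma borel_measurable_entry:
  "(\<lambda>x :: real ^ 'n ^ 'p. x $ i $ j) \<in> borel_measurable borel"
  by (intro borel_measurable_continuous_onI continuous_intros)

lemma borel_measurable_U_stat [measurable]: "U_stat \<in> borel_measurable borel"
  unfolding U_stat_def[abs_def]
  by (intro borel_measurable_vec_lambda borel_measurable_diff borel_measurable_entry)

lemma borel_measurable_Z_stat [measurable]:
  "(Z_stat j1 :: real ^ 'm ^ 'p \<Rightarrow> _) \<in> borel_measurable borel"
  unfolding Z_stat_def[abs_def]
proof (intro borel_measurable_vec_lambda)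
  fix i :: 'p and j :: 'm
  show "(\<lambda>u :: real ^ 'm ^ 'p. if j = j1 then u $ i $ j1 / \<bar>u $ i $ j1\<bar> else u $ i $ j / u $ i $ j1)
      \<in> borel_measurable borel"
    by (cases "j = j1"; simp only: simp_thms if_True if_False)
      (intro borel_measurable_divide borel_measurable_abs borel_measurable_entry)+
qed

lemma borel_measurable_scale_loss:
  assumes h: "strictly_convex h" and \<delta>: "\<delta> \<in> borel_measurable N"
  shows "(\<lambda>x. scale_loss h r (\<delta> x) \<beta>) \<in> borel_measurable N"
proof -
  note [measurable] = borel_measurable_if_strictly_convex[OF h]
    measurable_compose[OF \<delta> borel_measurable_nth]
  show ?thesis
    unfolding scale_loss_def by measurable
qed

text \<open>
  Row \<open>i\<close> of the matrix is scaled by \<open>\<beta>\<^sub>i\<close>, in each of its columns; hence the Jacobian of the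
  action is the power of the determinant that occurs in the density.
\<close>
lemma lborel_scale_rows:
  fixes \<alpha> \<beta> :: "real ^ 'p"
  assumes "pos_vec \<beta>"
  shows "lborel = density (distr lborel borel
      (\<lambda>x :: real ^ 'n ^ 'p. diag_mat \<beta> ** x + const_cols \<alpha>)) (\<lambda>_. ennreal (det (diag_mat \<beta>) ^ CARD('n)))"
proof -
  \<comment> \<open>A basis matrix has a single nonzero entry, so the sum selects the \<open>\<beta>\<^sub>i\<close> of its row.\<close>
  define c :: "real ^ 'n ^ 'p \<Rightarrow> real" where "c b = (\<Sum>i\<in>UNIV. \<Sum>j\<in>UNIV. \<beta> $ i * b $ i $ j)" for b
  have c_axis: "c (axis i (axis j 1)) = \<beta> $ i" for i j
  proof -
    have "c (axis i (axis j 1)) = (\<Sum>k\<in>UNIV. \<Sum>l\<in>UNIV. if k = i then (if l = j then \<beta> $ k else 0) else 0)"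
      unfolding c_def by (intro sum.cong) (auto simp: axis_def)
    also have "\<dots> = (\<Sum>k\<in>UNIV. if k = i then \<beta> $ k else 0)"
      by (intro sum.cong) auto
    finally show ?thesis
      by simp
  qed
  have Basis: "(Basis :: (real ^ 'n ^ 'p) set) = (\<lambda>(i, j). axis i (axis j 1)) ` (UNIV \<times> UNIV)"
    by (auto simp: Basis_vec_def)
  have inj: "inj_on (\<lambda>(i :: 'p, j :: 'n). axis i (axis j (1::real))) (UNIV \<times> UNIV)"
    by (auto simp: inj_on_def axis_eq_axis)
  have nz: "c b \<noteq> 0" if "b \<in> Basis" for b
    using that assms by (auto simp: Basis c_axis pos_vec_def less_le)
  have prod: "(\<Prod>b\<in>Basis. \<bar>c b\<bar>) = det (diag_mat \<beta>) ^ CARD('n)"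
  proof -
    have "(\<Prod>b\<in>Basis. \<bar>c b\<bar>) = (\<Prod>(i :: 'p, j :: 'n)\<in>UNIV \<times> UNIV. \<beta> $ i)"
      unfolding Basis using assms
      by (subst prod.reindex[OF inj]) (auto intro!: prod.cong simp: c_axis pos_vec_def less_imp_le)
    also have "\<dots> = (\<Prod>i\<in>UNIV. \<Prod>j\<in>(UNIV :: 'n set). \<beta> $ i)"
      by (rule prod.cartesian_product[symmetric])
    finally show ?thesis
      by (simp add: det_diag_mat prod_power_distrib)
  qed
  have map: "const_cols \<alpha> + (\<Sum>b\<in>Basis. (c b * (x \<bullet> b)) *\<^sub>R b) = diag_mat \<beta> ** x + const_cols \<alpha>"
    for x :: "real ^ 'n ^ 'p"
  proof (rule euclidean_eqI)
    fix b :: "real ^ 'n ^ 'p"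
    assume b: "b \<in> Basis"
    then obtain i j where ij: "b = axis i (axis j 1)"
      by (auto simp: Basis)
    have "(\<Sum>b\<in>Basis. (c b * (x \<bullet> b)) *\<^sub>R b) \<bullet> b = c b * (x \<bullet> b)"
      using b by simp
    then show "(const_cols \<alpha> + (\<Sum>b\<in>Basis. (c b * (x \<bullet> b)) *\<^sub>R b)) \<bullet> b
        = (diag_mat \<beta> ** x + const_cols \<alpha>) \<bullet> b"
      by (simp add: inner_add_left ij inner_axis c_axis diag_mat_mult_nth)
  qed
  show ?thesis
    using lborel_affine_euclidean[of c "const_cols \<alpha>", OF nz] by (simp add: map prod)
qed

lemma borel_measurable_scale_rows:
  "(\<lambda>x :: real ^ 'n ^ 'p. diag_mat \<beta> ** x + const_cols \<alpha>) \<in> borel_measurable borel"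
proof -
  have "(\<lambda>x :: real ^ 'n ^ 'p. diag_mat \<beta> ** x + const_cols \<alpha>)
      = (\<lambda>x. \<chi> i j. \<beta> $ i * x $ i $ j + \<alpha> $ i)"
    by (simp add: fun_eq_iff vec_eq_iff diag_mat_mult_nth const_cols_nth)
  then show ?thesis
    by (simp only:) (intro borel_measurable_vec_lambda borel_measurable_add borel_measurable_times
        borel_measurable_entry borel_measurable_const)
qed

lemma density_location_scale:
  fixes f :: "real ^ 'n ^ 'p \<Rightarrow> real"
  assumes f: "is_density f" and \<beta>: "pos_vec \<beta>"
    and meas: "(\<lambda>x. ennreal (location_scale_density f \<alpha> \<beta> x)) \<in> borel_measurable borel"
  shows "density lborel (location_scale_density f \<alpha> \<beta>)
    = distr (density lborel f) borel (\<lambda>x. diag_mat \<beta> ** x + const_cols \<alpha>)"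
proof -
  let ?\<Phi> = "\<lambda>x :: real ^ 'n ^ 'p. diag_mat \<beta> ** x + const_cols \<alpha>"
  let ?D = "det (diag_mat \<beta>) ^ CARD('n)"
  have D: "det (diag_mat \<beta>) > 0"
    using \<beta> by (auto simp: det_diag_mat pos_vec_def intro!: prod_pos)
  have "density lborel (location_scale_density f \<alpha> \<beta>)
      = density (density (distr lborel borel ?\<Phi>) (\<lambda>_. ennreal ?D)) (location_scale_density f \<alpha> \<beta>)"
    by (subst lborel_scale_rows[OF \<beta>, of \<alpha>]) simp
  also have "\<dots> = density (distr lborel borel ?\<Phi>) (\<lambda>x. ennreal ?D * location_scale_density f \<alpha> \<beta> x)"
    using meas by (intro density_density_eq) simp_all
  also have "\<dots> = distr (density lborel (\<lambda>x. ennreal ?D * location_scale_density f \<alpha> \<beta> (?\<Phi> x))) borel ?\<Phi>"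
    using meas borel_measurable_scale_rows by (intro density_distr) simp_all
  also have "(\<lambda>x. ennreal ?D * location_scale_density f \<alpha> \<beta> (?\<Phi> x)) = (\<lambda>x. ennreal (f x))"
  proof
    fix x
    have "location_scale_density f \<alpha> \<beta> (?\<Phi> x) = f x / ?D"
      by (simp add: location_scale_density_def matrix_inv_diag_mat_mult[OF \<beta>])
    moreover have "f x \<ge> 0"
      using f by (simp add: is_density_def)
    ultimately show "ennreal ?D * location_scale_density f \<alpha> \<beta> (?\<Phi> x) = ennreal (f x)"
      using D by (simp add: ennreal_mult'[symmetric])
  qed
  finally show ?thesis .
qed

lemma location_scale_density_0_1:
  fixes f :: "real ^ 'n ^ 'p \<Rightarrow> real"
  shows "location_scale_density f 0 1 = f"
proof -
  have "diag_mat 1 = (mat 1 :: real ^ 'p ^ 'p)"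
    by (simp add: diag_mat_def mat_def vec_eq_iff)
  moreover have "const_cols 0 = (0 :: real ^ 'n ^ 'p)"
    by (simp add: const_cols_def vec_eq_iff)
  moreover have "matrix_inv (diag_mat 1) ** (diag_mat 1 ** x) = x" for x :: "real ^ 'n ^ 'p"
    by (rule matrix_inv_diag_mat_mult[OF pos_vec_1])
  ultimately show ?thesis
    by (simp add: fun_eq_iff location_scale_density_def)
qed

lemma location_scale_model_law:
  fixes f :: "real ^ 'n ^ 'p \<Rightarrow> real"
  assumes model: "location_scale_model f M X" and \<beta>: "pos_vec \<beta>"
  shows "distr (M \<alpha> \<beta>) borel X = distr (distr (M 0 1) borel X) borel (\<lambda>x. diag_mat \<beta> ** x + const_cols \<alpha>)"
proof -
  have dist: "distributed (M a b) lborel X (\<lambda>x. ennreal (location_scale_density f a b x))"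
    if "pos_vec b" for a b
    using model that by (simp add: location_scale_model_def)
  have law: "distr (M a b) borel X = density lborel (location_scale_density f a b)"
    if "pos_vec b" for a b
    using dist[OF that, of a] by (simp add: distributed_def cong: distr_cong)
  have "is_density f"
    using model by (simp add: location_scale_model_def)
  moreover have "(\<lambda>x. ennreal (location_scale_density f \<alpha> \<beta> x)) \<in> borel_measurable borel"
    using dist[OF \<beta>, of \<alpha>] by (simp add: distributed_def)
  ultimately show ?thesis
    by (simp add: law[OF \<beta>] law[OF pos_vec_1] location_scale_density_0_1 density_location_scale[OF _ \<beta>])
qed

lemma scale_loss_equivariant:
  assumes \<delta>: "equivariant r \<delta>" and \<beta>: "pos_vec \<beta>"
  shows "scale_loss h r (\<delta> (diag_mat \<beta> ** x + const_cols \<alpha>)) \<beta> = scale_loss h r (\<delta> x) 1"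
proof -
  have "\<beta> $ i powr r \<noteq> 0" for i
    using \<beta> by (simp add: pos_vec_def less_imp_neq[THEN not_sym])
  moreover have "\<delta> (diag_mat \<beta> ** x + const_cols \<alpha>) = diag_mat (powr_vec \<beta> r) *v \<delta> x"
    using \<delta> \<beta> by (simp add: equivariant_def)
  ultimately show ?thesis
    by (simp add: scale_loss_def diag_mat_mult_vec_nth powr_vec_def)
qed

text \<open>
  Both the family of laws and the loss are transported by the same group action, so the comparison
  of two equivariant estimators needs to be made at a single parameter.
\<close>
lemma PC_equivariant:
  fixes f :: "real ^ 'n ^ 'p \<Rightarrow> real"
  assumes model: "location_scale_model f M X" and \<beta>: "pos_vec \<beta>" and h: "strictly_convex h"
    and \<delta>: "equivariant r \<delta>" "\<delta> \<in> borel_measurable borel"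
    and \<delta>': "equivariant r \<delta>'" "\<delta>' \<in> borel_measurable borel"
  shows "PC M X (scale_loss h r) \<delta> \<delta>' \<alpha> \<beta> = PC M X (scale_loss h r) \<delta> \<delta>' 0 1"
proof -
  define S where "S b = {x. scale_loss h r (\<delta> x) b < scale_loss h r (\<delta>' x) b}" for b
  have S: "S b \<in> sets borel" for b
  proof -
    note [measurable] = borel_measurable_scale_loss[OF h \<delta>(2)] borel_measurable_scale_loss[OF h \<delta>'(2)]
    show ?thesis
      unfolding S_def by measurable
  qed
  have PC: "PC M X (scale_loss h r) \<delta> \<delta>' a b = measure (distr (M a b) borel X) (S b)"
    if "pos_vec b" for a b
  proof -
    have "distributed (M a b) lborel X (\<lambda>x. ennreal (location_scale_density f a b x))"
      using model that by (simp add: location_scale_model_def)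
    then have "X \<in> borel_measurable (M a b)"
      by (simp add: distributed_def)
    with S show ?thesis
      unfolding PC_def by (subst measure_distr) (auto simp: S_def intro!: arg_cong[where f="measure _"])
  qed
  have "(\<lambda>x. diag_mat \<beta> ** x + const_cols \<alpha>) -` S \<beta> = S 1"
    by (simp add: S_def vimage_def scale_loss_equivariant[OF \<delta>(1) \<beta>] scale_loss_equivariant[OF \<delta>'(1) \<beta>])
  moreover have "(\<lambda>x :: real ^ 'n ^ 'p. diag_mat \<beta> ** x + const_cols \<alpha>) \<in> borel_measurable borel"
    by (rule borel_measurable_scale_rows)
  ultimately show ?thesis
    using S
    by (simp add: PC[OF \<beta>] PC[OF pos_vec_1] location_scale_model_law[OF model \<beta>, of \<alpha>] measure_distr)
qed


theorem theorem4p2: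
  fixes f :: "real ^ 'm::finite option ^ 'p::finite \<Rightarrow> real"
    and M :: "real ^ 'p \<Rightarrow> real ^ 'p \<Rightarrow> 'a measure"
    and X :: "'a \<Rightarrow> real ^ 'm option ^ 'p"
    and r :: real
    and h :: "real \<Rightarrow> real"
    and T :: "real ^ 'm ^ 'p \<Rightarrow> real ^ 'p"
    and j1 :: 'm
    and c_star :: "'a \<Rightarrow> real"
    and \<kappa> :: "real ^ 'm ^ 'p \<Rightarrow> real measure"
    and m :: "real ^ 'm ^ 'p \<Rightarrow> real"
  defines "Z \<equiv> \<lambda>\<omega>. Z_stat j1 (U_stat (X \<omega>))"
    and "\<delta>\<^sub>\<pi> \<equiv> \<lambda>x. m (Z_stat j1 (U_stat x)) *\<^sub>R T (U_stat x)"
  assumes "location_scale_model f M X"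
    and "r \<noteq> 0"
    and "T \<in> borel_measurable borel"
    and "equivariant r (\<lambda>x. T (U_stat x))"
    and "\<And>\<alpha> \<beta>. pos_vec \<beta> \<Longrightarrow> AE \<omega> in M \<alpha> \<beta>. pos_vec (T (U_stat (X \<omega>)))"
    and "strictly_convex h"
    and "c_star \<in> borel_measurable (M 0 1)"
    and "AE \<omega> in M 0 1. c_star_equation h (T (U_stat (X \<omega>))) (c_star \<omega>)"
    and "conditional_distribution (M 0 1) Z c_star \<kappa>"
    and "m \<in> borel_measurable borel"
    and "AE z in distr (M 0 1) borel Z. is_median (\<kappa> z) (m z)"
  shows "equivariant r \<delta>\<^sub>\<pi> \<and>
    pitman_closest M X (scale_loss h r) (Z_multiples j1 T) \<delta>\<^sub>\<pi>"
proof -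
  let ?N = "M 0 1"
  let ?Z = "\<lambda>x. Z_stat j1 (U_stat x)"
  let ?\<phi> = "\<lambda>\<omega> c. scale_loss h r (c *\<^sub>R T (U_stat (X \<omega>))) 1"
  note model = assms(3) and T[measurable] = assms(5) and equiv = assms(6) and h = assms(8)
    and c_star[measurable] = assms(9) and m[measurable] = assms(12)
  interpret N: prob_space ?N
    using model pos_vec_1 by (auto simp: location_scale_model_def)
  have [measurable]: "X \<in> borel_measurable ?N"
    using model pos_vec_1 unfolding location_scale_model_def distributed_def by fastforce
  have Z[measurable]: "Z \<in> borel_measurable ?N"
    unfolding Z_def by measurable
  have meas: "(\<lambda>x. w (?Z x) *\<^sub>R T (U_stat x)) \<in> borel_measurable borel"
    if [measurable]: "w \<in> borel_measurable borel" for w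
    by measurable
  have tails: "measure ?N {\<omega> \<in> space ?N. Z \<omega> \<in> A \<and> c_star \<omega> < m (Z \<omega>)}
      \<le> measure ?N {\<omega> \<in> space ?N. Z \<omega> \<in> A \<and> m (Z \<omega>) \<le> c_star \<omega>}"
    "measure ?N {\<omega> \<in> space ?N. Z \<omega> \<in> A \<and> m (Z \<omega>) < c_star \<omega>}
      \<le> measure ?N {\<omega> \<in> space ?N. Z \<omega> \<in> A \<and> c_star \<omega> \<le> m (Z \<omega>)}"
    if "A \<in> sets borel" for A
    using conditional_median_tails[OF N.prob_space_axioms Z c_star assms(11) m assms(13) that] by auto
  have "PC M X (scale_loss h r) \<delta>2 \<delta>\<^sub>\<pi> \<alpha> \<beta> \<le> PC M X (scale_loss h r) \<delta>\<^sub>\<pi> \<delta>2 \<alpha> \<beta>"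
    if \<delta>2: "\<delta>2 \<in> Z_multiples j1 T" and \<beta>: "pos_vec \<beta>" for \<delta>2 \<alpha> \<beta>
  proof -
    obtain w where w[measurable]: "w \<in> borel_measurable borel"
      and \<delta>2_eq: "\<delta>2 = (\<lambda>x. w (?Z x) *\<^sub>R T (U_stat x))"
      using \<delta>2 by (auto simp: Z_multiples_def)
    define Lo where "Lo = {z. w z < m z}"
    define Hi where "Hi = {z. m z < w z}"
    have [measurable]: "Lo \<in> sets borel" "Hi \<in> sets borel"
      unfolding Lo_def Hi_def by measurable
    have loss_meas[measurable]:
      "(\<lambda>\<omega>. ?\<phi> \<omega> (m (Z \<omega>))) \<in> borel_measurable ?N" "(\<lambda>\<omega>. ?\<phi> \<omega> (w (Z \<omega>))) \<in> borel_measurable ?N"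
      by (intro borel_measurable_scale_loss[OF h]; measurable)+
    \<comment> \<open>Moving the multiplier from b towards c_star, without passing it, lowers the loss.\<close>
    have towards: "AE \<omega> in ?N. \<forall>a b. b < a \<and> a \<le> c_star \<omega> \<or> c_star \<omega> \<le> a \<and> a < b
        \<longrightarrow> ?\<phi> \<omega> a < ?\<phi> \<omega> b"
      using assms(7)[OF pos_vec_1] assms(10)
    proof eventually_elim
      case (elim \<omega>)
      then show ?case
        using strictly_convex_less_towards_minimizer[OF strictly_convex_scale_loss_multiple[OF h]
            c_star_equation_minimizes[OF h]] by blast
    qed
    have "measure ?N {\<omega> \<in> space ?N. ?\<phi> \<omega> (w (Z \<omega>)) < ?\<phi> \<omega> (m (Z \<omega>))}
        \<le> measure ?N ({\<omega> \<in> space ?N. Z \<omega> \<in> Lo \<and> c_star \<omega> < m (Z \<omega>)}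
          \<union> {\<omega> \<in> space ?N. Z \<omega> \<in> Hi \<and> m (Z \<omega>) < c_star \<omega>})"
    proof (rule N.finite_measure_mono_AE)
      show "AE \<omega> in ?N. \<omega> \<in> {\<omega> \<in> space ?N. ?\<phi> \<omega> (w (Z \<omega>)) < ?\<phi> \<omega> (m (Z \<omega>))} \<longrightarrow>
          \<omega> \<in> {\<omega> \<in> space ?N. Z \<omega> \<in> Lo \<and> c_star \<omega> < m (Z \<omega>)}
            \<union> {\<omega> \<in> space ?N. Z \<omega> \<in> Hi \<and> m (Z \<omega>) < c_star \<omega>}"
        using towards
      proof eventually_elim
        case (elim \<omega>)
        show ?case
        proof
          assume \<omega>: "\<omega> \<in> {\<omega> \<in> space ?N. ?\<phi> \<omega> (w (Z \<omega>)) < ?\<phi> \<omega> (m (Z \<omega>))}"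
          then have "\<not> ?\<phi> \<omega> (m (Z \<omega>)) < ?\<phi> \<omega> (w (Z \<omega>))"
            by simp
          with spec[OF spec[OF elim, of "m (Z \<omega>)"], of "w (Z \<omega>)"]
          have "w (Z \<omega>) < m (Z \<omega>) \<Longrightarrow> c_star \<omega> < m (Z \<omega>)" "m (Z \<omega>) < w (Z \<omega>) \<Longrightarrow> m (Z \<omega>) < c_star \<omega>"
            by (simp_all add: not_le)
          moreover have "w (Z \<omega>) < m (Z \<omega>) \<or> m (Z \<omega>) < w (Z \<omega>)"
            using \<omega> by (cases "w (Z \<omega>)" "m (Z \<omega>)" rule: linorder_cases) auto
          ultimately show "\<omega> \<in> {\<omega> \<in> space ?N. Z \<omega> \<in> Lo \<and> c_star \<omega> < m (Z \<omega>)}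
              \<union> {\<omega> \<in> space ?N. Z \<omega> \<in> Hi \<and> m (Z \<omega>) < c_star \<omega>}"
            using \<omega> by (auto simp: Lo_def Hi_def)
        qed
      qed
    qed measurable
    also have "\<dots> \<le> measure ?N {\<omega> \<in> space ?N. Z \<omega> \<in> Lo \<and> c_star \<omega> < m (Z \<omega>)}
        + measure ?N {\<omega> \<in> space ?N. Z \<omega> \<in> Hi \<and> m (Z \<omega>) < c_star \<omega>}"
      by (intro measure_Un_le) measurable
    also have "\<dots> \<le> measure ?N {\<omega> \<in> space ?N. Z \<omega> \<in> Lo \<and> m (Z \<omega>) \<le> c_star \<omega>}
        + measure ?N {\<omega> \<in> space ?N. Z \<omega> \<in> Hi \<and> c_star \<omega> \<le> m (Z \<omega>)}"
      by (intro add_mono tails) simp_all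
    also have "\<dots> = measure ?N ({\<omega> \<in> space ?N. Z \<omega> \<in> Lo \<and> m (Z \<omega>) \<le> c_star \<omega>}
        \<union> {\<omega> \<in> space ?N. Z \<omega> \<in> Hi \<and> c_star \<omega> \<le> m (Z \<omega>)})"
      by (intro N.finite_measure_Union[symmetric]) (auto simp: Lo_def Hi_def)
    also have "\<dots> \<le> measure ?N {\<omega> \<in> space ?N. ?\<phi> \<omega> (m (Z \<omega>)) < ?\<phi> \<omega> (w (Z \<omega>))}"
    proof (rule N.finite_measure_mono_AE)
      show "AE \<omega> in ?N. \<omega> \<in> {\<omega> \<in> space ?N. Z \<omega> \<in> Lo \<and> m (Z \<omega>) \<le> c_star \<omega>}
            \<union> {\<omega> \<in> space ?N. Z \<omega> \<in> Hi \<and> c_star \<omega> \<le> m (Z \<omega>)} \<longrightarrow>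
          \<omega> \<in> {\<omega> \<in> space ?N. ?\<phi> \<omega> (m (Z \<omega>)) < ?\<phi> \<omega> (w (Z \<omega>))}"
        using towards by eventually_elim (auto simp: Lo_def Hi_def)
    qed measurable
    finally have "PC M X (scale_loss h r) \<delta>2 \<delta>\<^sub>\<pi> 0 1 \<le> PC M X (scale_loss h r) \<delta>\<^sub>\<pi> \<delta>2 0 1"
      by (simp add: PC_def \<delta>2_eq \<delta>\<^sub>\<pi>_def Z_def)
    then show ?thesis
      using PC_equivariant[OF model \<beta> h, of r \<delta>2 \<delta>\<^sub>\<pi> \<alpha>] PC_equivariant[OF model \<beta> h, of r \<delta>\<^sub>\<pi> \<delta>2 \<alpha>]
        equivariant_Z_multiple[OF equiv] meas[OF w] meas[OF m]
      by (simp add: \<delta>2_eq \<delta>\<^sub>\<pi>_def)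
  qed
  moreover have "\<delta>\<^sub>\<pi> \<in> Z_multiples j1 T"
    using m by (auto simp: Z_multiples_def \<delta>\<^sub>\<pi>_def)
  ultimately show ?thesis
    using equivariant_Z_multiple[OF equiv] by (auto simp: pitman_closest_def \<delta>\<^sub>\<pi>_def)
qed

end
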